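(* Let $n>2$. The map $co: w\mapsto\tilde w$ is a group isomorphism from $PG_n^2=\mathrm{Ker}(l)\subset G_n^2$ onto the subgroup $\mathrm{Ker}(m)\subset C(n,2)$.
   Context: Let $n>2$. Generators are indexed by unordered pairs of distinct elements of $\{1,\dots,n\}$ (so $a_{ij}=a_{ji}$, $b_{ij}=b_{ji}$). The group $G_n^2$ has generators $a_{ij}$ and defining relations: $a_{ij}a_{ik}a_{jk}=a_{jk}a_{ik}a_{ij}$ for all distinct $i,j,k$; $a_{ij}a_{kl}=a_{kl}a_{ij}$ for all pairwise distinct $i,j,k,l$; $a_{ij}^2=1$ for all $i\neq j$. The Coxeter group $C(n,2)$ has generators $b_{ij}$ and defining relations: $(b_{ij}b_{ik})^3=1$ for all distinct $i,j,k$; $b_{ij}b_{kl}=b_{kl}b_{ij}$ for all pairwise distinct $i,j,k,l$; $b_{ij}^2=1$ for all $i\ne j$. Convention: products in the symmetric group $S_n$ are read from left to right, i.e. $\alpha\beta$ means "first apply $\alpha$, then $\beta$", so $(\alpha\beta)(x)=\beta(\alpha(x))$. Let $l:G_n^2\to S_n$ and $m:C(n,2)\to S_n$ be the homomorphisms sending $a_{ij}$, respectively $b_{ij}$, to the transposition $(i\,j)$. Put $PG_n^2=\mathrm{Ker}(l)$. Rewriting $w\mapsto\tilde w$: let $w=a_{i_{1,1},i_{1,2}}a_{i_{2,1},i_{2,2}}\cdots a_{i_{k,1},i_{k,2}}$ be a word. For $0\le p\le k$ let $w_p$ be the product of the first $p$ letters of $w$ ($w_0$ is the empty word) and put $\sigma_p=l(w_p)^{-1}$,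 $\sigma_0=\mathrm{id}$. Thus $\sigma_{p+1}$ is obtained by multiplying $\sigma_p$ on the left by the transposition $(i_{p+1,1}\ i_{p+1,2})$; with the convention that products in $S_n$ are read from left to right, $\sigma_{p+1}(x)=\sigma_p\big((i_{p+1,1}\ i_{p+1,2})(x)\big)$. Then $$\tilde w=b_{\sigma_0(i_{1,1}),\sigma_0(i_{1,2})}\,b_{\sigma_1(i_{2,1}),\sigma_1(i_{2,2})}\cdots b_{\sigma_{k-1}(i_{k,1}),\sigma_{k-1}(i_{k,2})}.$$ The element of $C(n,2)$ represented by $\tilde w$ depends only on the element of $G_n^2$ represented by $w$; the map $co$ sends the element of $PG_n^2$ represented by a word $w$ to the element of $C(n,2)$ represented by $\tilde w$. *)

theory Defs
  imports "HOL-Algebra.Sym_Groups"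
begin

section \<open>Groups given by generators and relations\<close>

text \<open>A letter \<open>(g, True)\<close> stands for the generator \<open>g\<close>, a letter \<open>(g, False)\<close> for its formal
  inverse. A relation \<open>u = v\<close> is given as the pair \<open>(u, v)\<close> of words.\<close>

type_synonym 'g word = "('g \<times> bool) list"

definition words :: "'g set \<Rightarrow> 'g word set" where
  "words S = lists (S \<times> UNIV)"

inductive pres_eq :: "'g set \<Rightarrow> ('g word \<times> 'g word) set \<Rightarrow> 'g word \<Rightarrow> 'g word \<Rightarrow> bool"
  for S R where
  refl: "u \<in> words S \<Longrightarrow> pres_eq S R u u"
| sym: "pres_eq S R u v \<Longrightarrow> pres_eq S R v u"
| trans: "pres_eq S R u v \<Longrightarrow> pres_eq S R v w \<Longrightarrow> pres_eq S R u w"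
| append: "pres_eq S R u u' \<Longrightarrow> pres_eq S R v v' \<Longrightarrow> pres_eq S R (u @ v) (u' @ v')"
| cancel: "g \<in> S \<Longrightarrow> pres_eq S R [(g, e), (g, \<not> e)] []"
| rel: "(u, v) \<in> R \<Longrightarrow> u \<in> words S \<Longrightarrow> v \<in> words S \<Longrightarrow> pres_eq S R u v"

definition pres_class :: "'g set \<Rightarrow> ('g word \<times> 'g word) set \<Rightarrow> 'g word \<Rightarrow> 'g word set" where
  "pres_class S R u = {v. pres_eq S R u v}"

definition presented_group :: "'g set \<Rightarrow> ('g word \<times> 'g word) set \<Rightarrow> 'g word set monoid" where
  "presented_group S R =
     \<lparr>carrier = pres_class S R ` words S,
      mult = (\<lambda>X Y. \<Union>x\<in>X. \<Union>y\<in>Y. pres_class S R (x @ y)),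
      one = pres_class S R []\<rparr>"

fun word_eval :: "('h, 'm) monoid_scheme \<Rightarrow> ('g \<Rightarrow> 'h) \<Rightarrow> 'g word \<Rightarrow> 'h" where
  "word_eval H f [] = \<one>\<^bsub>H\<^esub>"
| "word_eval H f ((g, e) # w) = (if e then f g else inv\<^bsub>H\<^esub> (f g)) \<otimes>\<^bsub>H\<^esub> word_eval H f w"

text \<open>The homomorphism from a presented group to \<open>H\<close> determined by the images \<open>f g\<close> of the
  generators, provided that these satisfy the relations (\<open>induced_hom_in_hom\<close> below).\<close>

definition induced_hom :: "('h, 'm) monoid_scheme \<Rightarrow> ('g \<Rightarrow> 'h) \<Rightarrow> 'g word set \<Rightarrow> 'h" where
  "induced_hom H f X = the_elem (word_eval H f ` X)"

lemma words_iff: "w \<in> words S \<longleftrightarrow> (\<forall>x\<in>set w. fst x \<in> S)"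
  by (simp add: words_def in_lists_conv_set mem_Times_iff)

lemma words_Nil [simp]: "[] \<in> words S"
  and words_Cons [simp]: "x # w \<in> words S \<longleftrightarrow> fst x \<in> S \<and> w \<in> words S"
  and words_append [simp]: "u @ v \<in> words S \<longleftrightarrow> u \<in> words S \<and> v \<in> words S"
  by (auto simp: words_iff)

lemma pres_eq_words: "pres_eq S R u v \<Longrightarrow> u \<in> words S \<and> v \<in> words S"
  by (induction rule: pres_eq.induct) auto

lemma pres_class_eq_iff:
  "u \<in> words S \<Longrightarrow> pres_class S R u = pres_class S R v \<longleftrightarrow> pres_eq S R u v"
  unfolding pres_class_def set_eq_iff mem_Collect_eq
  by (meson pres_eq.refl pres_eq.sym pres_eq.trans)

lemma pres_class_mult:
  assumes "u \<in> words S" "v \<in> words S"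
  shows "pres_class S R u \<otimes>\<^bsub>presented_group S R\<^esub> pres_class S R v = pres_class S R (u @ v)"
proof -
  have "pres_class S R (x @ y) = pres_class S R (u @ v)"
    if "x \<in> pres_class S R u" "y \<in> pres_class S R v" for x y
  proof -
    have *: "pres_eq S R u x" "pres_eq S R v y"
      using that by (auto simp: pres_class_def)
    have E: "pres_eq S R (x @ y) (u @ v)"
      by (intro pres_eq.append pres_eq.sym[OF *(1)] pres_eq.sym[OF *(2)])
    show ?thesis
      using pres_class_eq_iff[OF conjunct1[OF pres_eq_words[OF E]]] E by (rule iffD2)
  qed
  moreover have "u \<in> pres_class S R u" "v \<in> pres_class S R v"
    using assms by (auto simp: pres_class_def intro: pres_eq.refl)
  ultimately show ?thesis
    unfolding presented_group_def monoid.simps by blast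
qed

lemma pres_class_in_carrier [simp]:
  "u \<in> words S \<Longrightarrow> pres_class S R u \<in> carrier (presented_group S R)"
  by (simp add: presented_group_def)

lemma pres_eq_inverse:
  "w \<in> words S \<Longrightarrow> pres_eq S R (rev (map (\<lambda>(g, e). (g, \<not> e)) w) @ w) []"
proof (induction w)
  case (Cons x w)
  obtain g e where x: "x = (g, e)" by (cases x)
  let ?r = "rev (map (\<lambda>(g, e). (g, \<not> e)) w)"
  have r: "?r \<in> words S"
    using Cons.prems by (auto simp: words_iff split_beta)
  have "pres_eq S R [(g, \<not> e), (g, \<not> \<not> e)] []"
    using Cons.prems x by (intro pres_eq.cancel) auto
  hence "pres_eq S R (?r @ ([(g, \<not> e), (g, e)] @ w)) (?r @ ([] @ w))"
    using r Cons.prems by (intro pres_eq.append) (auto intro: pres_eq.refl)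
  moreover have "pres_eq S R (?r @ w) []"
    using Cons by auto
  ultimately show ?case
    using x pres_eq.trans[of S R _ "?r @ w" "[]"] by simp
qed (simp add: pres_eq.refl)

lemma presented_group_is_group: "group (presented_group S R)"
proof (rule groupI)
  fix X assume "X \<in> carrier (presented_group S R)"
  then obtain w where w: "w \<in> words S" "X = pres_class S R w"
    by (auto simp: presented_group_def)
  let ?r = "rev (map (\<lambda>(g, e). (g, \<not> e)) w)"
  have r: "?r \<in> words S"
    using w by (auto simp: words_iff split_beta)
  have "pres_class S R ?r \<otimes>\<^bsub>presented_group S R\<^esub> X = pres_class S R (?r @ w)"
    using r w by (simp add: pres_class_mult)
  also have "\<dots> = \<one>\<^bsub>presented_group S R\<^esub>"
    using r w pres_eq_inverse[of w S R]
    by (subst presented_group_def) (simp add: pres_class_eq_iff)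
  finally show "\<exists>Y\<in>carrier (presented_group S R). Y \<otimes>\<^bsub>presented_group S R\<^esub> X = \<one>\<^bsub>presented_group S R\<^esub>"
    using r by (intro bexI[of _ "pres_class S R ?r"]) auto
  have one: "\<one>\<^bsub>presented_group S R\<^esub> = pres_class S R []"
    by (simp add: presented_group_def)
  show "\<one>\<^bsub>presented_group S R\<^esub> \<otimes>\<^bsub>presented_group S R\<^esub> X = X"
    using w by (simp add: one pres_class_mult)
next
  show "\<one>\<^bsub>presented_group S R\<^esub> \<in> carrier (presented_group S R)"
    by (simp add: presented_group_def)
next
  have *: "\<And>X. X \<in> carrier (presented_group S R) \<Longrightarrow> \<exists>w\<in>words S. X = pres_class S R w"
    by (auto simp: presented_group_def)
  fix X Y assume XY: "X \<in> carrier (presented_group S R)" "Y \<in> carrier (presented_group S R)"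
  then obtain u v where uv: "u \<in> words S" "v \<in> words S" "X = pres_class S R u" "Y = pres_class S R v"
    using * by metis
  thus "X \<otimes>\<^bsub>presented_group S R\<^esub> Y \<in> carrier (presented_group S R)"
    by (simp add: pres_class_mult)
  fix Z assume "Z \<in> carrier (presented_group S R)"
  then obtain w where w: "w \<in> words S" "Z = pres_class S R w"
    using * by metis
  show "X \<otimes>\<^bsub>presented_group S R\<^esub> Y \<otimes>\<^bsub>presented_group S R\<^esub> Z =
        X \<otimes>\<^bsub>presented_group S R\<^esub> (Y \<otimes>\<^bsub>presented_group S R\<^esub> Z)"
    using uv w by (simp add: pres_class_mult)
qed

lemma word_eval_closed:
  assumes "group H" "f \<in> S \<rightarrow> carrier H" "w \<in> words S"
  shows "word_eval H f w \<in> carrier H"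
  using assms(3)
proof (induction w)
  case (Cons x w)
  interpret H: group H by fact
  from Cons assms(2) show ?case by (cases x) auto
qed (use assms(1) in \<open>simp add: group.is_monoid\<close>)

lemma word_eval_append:
  assumes "group H" "f \<in> S \<rightarrow> carrier H" "u \<in> words S" "v \<in> words S"
  shows "word_eval H f (u @ v) = word_eval H f u \<otimes>\<^bsub>H\<^esub> word_eval H f v"
  using assms(3)
proof (induction u)
  case Nil
  interpret H: group H by fact
  show ?case using word_eval_closed[OF assms(1,2,4)] by simp
next
  case (Cons x u)
  interpret H: group H by fact
  obtain g e where "x = (g, e)" by (cases x)
  thus ?case
    using Cons assms(2) word_eval_closed[OF assms(1,2,4)] word_eval_closed[OF assms(1,2), of u]
    by (auto simp: H.m_assoc Pi_iff)
qed

lemma pres_eq_word_eval: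
  assumes "group H" "f \<in> S \<rightarrow> carrier H"
    and "\<And>u v. (u, v) \<in> R \<Longrightarrow> word_eval H f u = word_eval H f v"
    and "pres_eq S R u v"
  shows "word_eval H f u = word_eval H f v"
  using assms(4)
proof (induction rule: pres_eq.induct)
  case (append u u' v v')
  thus ?case
    using word_eval_append[OF assms(1,2)] pres_eq_words by metis
next
  case (cancel g e)
  interpret H: group H by fact
  have "f g \<in> carrier H" using cancel assms(2) by blast
  thus ?case by (cases e) auto
qed (use assms(3) in auto)

lemma induced_hom_pres_class:
  assumes "group H" "f \<in> S \<rightarrow> carrier H"
    and "\<And>u v. (u, v) \<in> R \<Longrightarrow> word_eval H f u = word_eval H f v"
    and "w \<in> words S"
  shows "induced_hom H f (pres_class S R w) = word_eval H f w"
proof -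
  have "word_eval H f ` pres_class S R w = {word_eval H f w}"
    using pres_eq_word_eval[OF assms(1-3)] pres_eq.refl[OF assms(4)]
    by (fastforce simp: pres_class_def)
  thus ?thesis by (simp add: induced_hom_def)
qed

lemma induced_hom_in_hom:
  assumes "group H" "f \<in> S \<rightarrow> carrier H"
    and "\<And>u v. (u, v) \<in> R \<Longrightarrow> word_eval H f u = word_eval H f v"
  shows "induced_hom H f \<in> hom (presented_group S R) H"
    and "g \<in> S \<Longrightarrow> induced_hom H f (pres_class S R [(g, True)]) = f g"
proof -
  note ind = induced_hom_pres_class[of H f S R, OF assms]
  show "induced_hom H f \<in> hom (presented_group S R) H"
  proof (rule homI)
    fix X assume "X \<in> carrier (presented_group S R)"
    then obtain u where u: "u \<in> words S" "X = pres_class S R u"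
      by (auto simp: presented_group_def)
    thus "induced_hom H f X \<in> carrier H"
      using word_eval_closed[OF assms(1,2)] by (simp add: ind)
    fix Y assume "Y \<in> carrier (presented_group S R)"
    then obtain v where v: "v \<in> words S" "Y = pres_class S R v"
      by (auto simp: presented_group_def)
    show "induced_hom H f (X \<otimes>\<^bsub>presented_group S R\<^esub> Y) = induced_hom H f X \<otimes>\<^bsub>H\<^esub> induced_hom H f Y"
      using u v word_eval_append[OF assms(1,2)] by (simp add: ind pres_class_mult)
  qed
  interpret H: group H by fact
  show "g \<in> S \<Longrightarrow> induced_hom H f (pres_class S R [(g, True)]) = f g"
    using assms(2) by (subst ind) (auto simp: Pi_iff)
qed

definition pos :: "'g list \<Rightarrow> 'g word" where
  "pos gs = map (\<lambda>g. (g, True)) gs"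

lemma pos_simps [simp]:
  "pos [] = []" "pos (g # gs) = (g, True) # pos gs" "pos (gs @ hs) = pos gs @ pos hs"
  by (auto simp: pos_def)

lemma pos_in_words [simp]: "pos gs \<in> words S \<longleftrightarrow> set gs \<subseteq> S"
  by (induction gs) auto

section \<open>The groups \<open>G\<^sub>n\<^sup>2\<close> and \<open>C(n,2)\<close>\<close>

text \<open>The generators \<open>a\<^sub>i\<^sub>j\<close> of \<open>G\<^sub>n\<^sup>2\<close> and \<open>b\<^sub>i\<^sub>j\<close> of \<open>C(n,2)\<close> are both represented by
  their index, the set \<open>{i, j}\<close>.\<close>

definition pairs :: "nat \<Rightarrow> nat set set" where
  "pairs n = {{i, j} | i j. i \<in> {1..n} \<and> j \<in> {1..n} \<and> i \<noteq> j}"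

definition G2_rels :: "nat \<Rightarrow> (nat set word \<times> nat set word) set" where
  "G2_rels n =
     {(pos [{i,j}, {i,k}, {j,k}], pos [{j,k}, {i,k}, {i,j}]) | i j k.
        {i,j,k} \<subseteq> {1..n} \<and> distinct [i,j,k]} \<union>
     {(pos [{i,j}, {k,l}], pos [{k,l}, {i,j}]) | i j k l.
        {i,j,k,l} \<subseteq> {1..n} \<and> distinct [i,j,k,l]} \<union>
     {(pos [{i,j}, {i,j}], []) | i j. {i,j} \<subseteq> {1..n} \<and> i \<noteq> j}"

definition C2_rels :: "nat \<Rightarrow> (nat set word \<times> nat set word) set" where
  "C2_rels n =
     {(pos [{i,j}, {i,k}, {i,j}, {i,k}, {i,j}, {i,k}], []) | i j k.
        {i,j,k} \<subseteq> {1..n} \<and> distinct [i,j,k]} \<union>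
     {(pos [{i,j}, {k,l}], pos [{k,l}, {i,j}]) | i j k l.
        {i,j,k,l} \<subseteq> {1..n} \<and> distinct [i,j,k,l]} \<union>
     {(pos [{i,j}, {i,j}], []) | i j. {i,j} \<subseteq> {1..n} \<and> i \<noteq> j}"

definition G2 :: "nat \<Rightarrow> nat set word set monoid" where
  "G2 n = presented_group (pairs n) (G2_rels n)"

definition C2 :: "nat \<Rightarrow> nat set word set monoid" where
  "C2 n = presented_group (pairs n) (C2_rels n)"

text \<open>The elements represented by words in the \<open>a\<^sub>i\<^sub>j\<close>, respectively the \<open>b\<^sub>i\<^sub>j\<close>.\<close>

definition G2_elem :: "nat \<Rightarrow> nat set list \<Rightarrow> nat set word set" where
  "G2_elem n w = pres_class (pairs n) (G2_rels n) (pos w)"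

definition C2_elem :: "nat \<Rightarrow> nat set list \<Rightarrow> nat set word set" where
  "C2_elem n w = pres_class (pairs n) (C2_rels n) (pos w)"

text \<open>The symmetric group with products read from left to right, so that
  \<open>(\<alpha> \<beta>)(x) = \<beta>(\<alpha>(x))\<close>; the library group \<open>sym_group\<close> uses the opposite convention.\<close>

definition Sym_lr :: "nat \<Rightarrow> (nat \<Rightarrow> nat) monoid" where
  "Sym_lr n = (sym_group n)\<lparr>mult := (\<lambda>\<alpha> \<beta>. \<beta> \<circ> \<alpha>)\<rparr>"

definition pair_transp :: "nat set \<Rightarrow> nat \<Rightarrow> nat" where
  "pair_transp e = transpose (Min e) (Max e)"

lemma transp_pair [simp]: "pair_transp {i, j} = transpose i j"
  by (cases "i \<le> j") (auto simp: pair_transp_def transpose_commute max_def min_def)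

definition l_hom :: "nat \<Rightarrow> nat set word set \<Rightarrow> nat \<Rightarrow> nat" where
  "l_hom n = induced_hom (Sym_lr n) pair_transp"

definition m_hom :: "nat \<Rightarrow> nat set word set \<Rightarrow> nat \<Rightarrow> nat" where
  "m_hom n = induced_hom (Sym_lr n) pair_transp"

definition Ker_l :: "nat \<Rightarrow> nat set word set monoid" where
  "Ker_l n = (G2 n)\<lparr>carrier := kernel (G2 n) (Sym_lr n) (l_hom n)\<rparr>"

definition Ker_m :: "nat \<Rightarrow> nat set word set monoid" where
  "Ker_m n = (C2 n)\<lparr>carrier := kernel (C2 n) (Sym_lr n) (m_hom n)\<rparr>"

section \<open>The map \<open>co\<close>\<close>

definition sig :: "nat \<Rightarrow> nat set list \<Rightarrow> nat \<Rightarrow> nat \<Rightarrow> nat" where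
  "sig n w p = inv\<^bsub>Sym_lr n\<^esub> (l_hom n (G2_elem n (take p w)))"

text \<open>The image of the index \<open>{i, j}\<close> under \<open>\<sigma>\<close> is \<open>{\<sigma> i, \<sigma> j}\<close>.\<close>

definition tilde :: "nat \<Rightarrow> nat set list \<Rightarrow> nat set list" where
  "tilde n w = map (\<lambda>p. sig n w p ` (w ! p)) [0..<length w]"

text \<open>The value does not depend on the word chosen (\<open>co_G2_elem\<close> below).\<close>

definition co :: "nat \<Rightarrow> nat set word set \<Rightarrow> nat set word set" where
  "co n X = (THE Y. \<exists>w\<in>lists (pairs n). X = G2_elem n w \<and> Y = C2_elem n (tilde n w))"

section \<open>Well-definedness\<close>

declare One_nat_def [simp del]

lemma transp_permutes: "e \<in> pairs n \<Longrightarrow> pair_transp e permutes {1..n}"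
  by (auto simp: pairs_def permutes_swap_id)

lemma Sym_lr_carrier [simp]: "p \<in> carrier (Sym_lr n) \<longleftrightarrow> p permutes {1..n}"
  and Sym_lr_mult [simp]: "p \<otimes>\<^bsub>Sym_lr n\<^esub> q = q \<circ> p"
  and Sym_lr_one [simp]: "\<one>\<^bsub>Sym_lr n\<^esub> = id"
  by (simp_all add: Sym_lr_def sym_group_def)

lemma Sym_lr_is_group: "group (Sym_lr n)"
proof (rule groupI)
  fix p assume "p \<in> carrier (Sym_lr n)"
  thus "\<exists>q\<in>carrier (Sym_lr n). q \<otimes>\<^bsub>Sym_lr n\<^esub> p = \<one>\<^bsub>Sym_lr n\<^esub>"
    by (intro bexI[of _ "inv' p"]) (auto simp: permutes_inv permutes_inv_o)
qed (auto simp: permutes_compose permutes_id comp_assoc)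

lemma transp_in_Sym_lr: "pair_transp \<in> pairs n \<rightarrow> carrier (Sym_lr n)"
  by (auto simp: transp_permutes)

lemma G2_rels_cases:
  assumes "(u, v) \<in> G2_rels n"
  obtains (triangle) i j k where "{i,j,k} \<subseteq> {1..n}" "distinct [i,j,k]"
      "u = pos [{i,j}, {i,k}, {j,k}]" "v = pos [{j,k}, {i,k}, {i,j}]"
    | (far) i j k l where "{i,j,k,l} \<subseteq> {1..n}" "distinct [i,j,k,l]"
      "u = pos [{i,j}, {k,l}]" "v = pos [{k,l}, {i,j}]"
    | (square) i j where "{i,j} \<subseteq> {1..n}" "i \<noteq> j" "u = pos [{i,j}, {i,j}]" "v = []"
  using assms unfolding G2_rels_def Un_iff mem_Collect_eq prod.inject
  by (elim disjE exE conjE) ((rule that(1); assumption), (rule that(2); assumption), (rule that(3); assumption))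

lemma C2_rels_cases:
  assumes "(u, v) \<in> C2_rels n"
  obtains (triangle) i j k where "{i,j,k} \<subseteq> {1..n}" "distinct [i,j,k]"
      "u = pos [{i,j}, {i,k}, {i,j}, {i,k}, {i,j}, {i,k}]" "v = []"
    | (far) i j k l where "{i,j,k,l} \<subseteq> {1..n}" "distinct [i,j,k,l]"
      "u = pos [{i,j}, {k,l}]" "v = pos [{k,l}, {i,j}]"
    | (square) i j where "{i,j} \<subseteq> {1..n}" "i \<noteq> j" "u = pos [{i,j}, {i,j}]" "v = []"
  using assms unfolding C2_rels_def Un_iff mem_Collect_eq prod.inject
  by (elim disjE exE conjE) ((rule that(1); assumption), (rule that(2); assumption), (rule that(3); assumption))

lemma transpose_triangle:
  assumes "distinct [i, j, k]"
  shows "transpose j k \<circ> transpose i k \<circ> transpose i j =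
         transpose i j \<circ> transpose i k \<circ> transpose j k"
proof -
  have "i \<noteq> j" "j \<noteq> i" "i \<noteq> k" "k \<noteq> i" "j \<noteq> k" "k \<noteq> j" using assms by auto
  thus ?thesis by (intro ext) (simp add: transpose_def)
qed

lemma transpose_cube:
  assumes "distinct [i, j, k]"
  shows "transpose i k \<circ> transpose i j \<circ> transpose i k \<circ> transpose i j \<circ>
         transpose i k \<circ> transpose i j = id"
proof -
  have "i \<noteq> j" "j \<noteq> i" "i \<noteq> k" "k \<noteq> i" "j \<noteq> k" "k \<noteq> j" using assms by auto
  thus ?thesis by (intro ext) (simp add: transpose_def)
qed

lemma transpose_far:
  assumes "distinct [i, j, k, l]"
  shows "transpose i j \<circ> transpose k l = transpose k l \<circ> transpose i j"
proof -
  have "i \<noteq> j" "j \<noteq> i" "i \<noteq> k" "k \<noteq> i" "j \<noteq> k" "k \<noteq> j"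
    "i \<noteq> l" "l \<noteq> i" "j \<noteq> l" "l \<noteq> j" "k \<noteq> l" "l \<noteq> k" using assms by auto
  thus ?thesis by (intro ext) (simp add: transpose_def)
qed

lemma G2_rels_sound:
  assumes "(u, v) \<in> G2_rels n"
  shows "word_eval (Sym_lr n) pair_transp u = word_eval (Sym_lr n) pair_transp v"
  using assms
proof (cases rule: G2_rels_cases)
  case (triangle i j k)
  thus ?thesis using transpose_triangle[of i j k] by (simp add: comp_assoc del: comp_apply)
next
  case (far i j k l)
  thus ?thesis using transpose_far[of i j k l] by (simp del: comp_apply)
qed simp

lemma C2_rels_sound:
  assumes "(u, v) \<in> C2_rels n"
  shows "word_eval (Sym_lr n) pair_transp u = word_eval (Sym_lr n) pair_transp v"
  using assms
proof (cases rule: C2_rels_cases)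
  case (triangle i j k)
  thus ?thesis using transpose_cube[of i j k] by (simp add: comp_assoc del: comp_apply)
next
  case (far i j k l)
  thus ?thesis using transpose_far[of i j k l] by (simp del: comp_apply)
qed simp

lemma pair_in_pairs [simp]: "{i, j} \<in> pairs n \<longleftrightarrow> i \<in> {1..n} \<and> j \<in> {1..n} \<and> i \<noteq> j"
  unfolding pairs_def by (auto simp: doubleton_eq_iff)

lemma l_hom:
  "l_hom n \<in> hom (G2 n) (Sym_lr n)"
  "{i, j} \<in> pairs n \<Longrightarrow> l_hom n (G2_elem n [{i, j}]) = transpose i j"
  using induced_hom_in_hom[OF Sym_lr_is_group transp_in_Sym_lr G2_rels_sound]
  by (simp_all add: l_hom_def G2_def G2_elem_def del: pair_in_pairs)

lemma m_hom:
  "m_hom n \<in> hom (C2 n) (Sym_lr n)"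
  "{i, j} \<in> pairs n \<Longrightarrow> m_hom n (C2_elem n [{i, j}]) = transpose i j"
  using induced_hom_in_hom[OF Sym_lr_is_group transp_in_Sym_lr C2_rels_sound]
  by (simp_all add: m_hom_def C2_def C2_elem_def del: pair_in_pairs)

lemma Ker_l_is_group: "group (Ker_l n)"
  and Ker_m_is_group: "group (Ker_m n)"
proof -
  have "group_hom (G2 n) (Sym_lr n) (l_hom n)" "group_hom (C2 n) (Sym_lr n) (m_hom n)"
    using l_hom(1) m_hom(1) Sym_lr_is_group presented_group_is_group
    by (auto simp: group_hom_def group_hom_axioms_def G2_def C2_def)
  thus "group (Ker_l n)" "group (Ker_m n)"
    unfolding Ker_l_def Ker_m_def
    by (auto intro!: subgroup.subgroup_is_group group_hom.subgroup_kernel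
          simp: G2_def C2_def presented_group_is_group)
qed

text \<open>The rewriting started at an arbitrary permutation \<open>\<sigma>\<close>, ignoring the signs of letters.\<close>

fun twist :: "(nat \<Rightarrow> nat) \<Rightarrow> nat set word \<Rightarrow> nat set list" where
  "twist \<sigma> [] = []"
| "twist \<sigma> (x # w) = (\<sigma> ` fst x) # twist (\<sigma> \<circ> pair_transp (fst x)) w"

fun perm :: "nat set word \<Rightarrow> nat \<Rightarrow> nat" where
  "perm [] = id"
| "perm (x # w) = pair_transp (fst x) \<circ> perm w"

lemma perm_append: "perm (u @ v) = perm u \<circ> perm v"
  by (induction u) (auto simp: comp_assoc)

lemma perm_permutes: "w \<in> words (pairs n) \<Longrightarrow> perm w permutes {1..n}"
  by (induction w) (auto simp: permutes_id intro!: permutes_compose transp_permutes)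

lemma twist_append: "twist \<sigma> (u @ v) = twist \<sigma> u @ twist (\<sigma> \<circ> perm u) v"
  by (induction u arbitrary: \<sigma>) (auto simp: comp_assoc)

lemma image_in_pairs:
  assumes "\<sigma> permutes {1..n}" "e \<in> pairs n"
  shows "\<sigma> ` e \<in> pairs n"
proof -
  obtain i j where e: "e = {i, j}" "i \<in> {1..n}" "j \<in> {1..n}" "i \<noteq> j"
    using assms(2) unfolding pairs_def by blast
  have "\<sigma> i \<noteq> \<sigma> j"
    using permutes_inj[OF assms(1)] e(4) by (auto simp: inj_eq)
  thus ?thesis
    using e permutes_in_image[OF assms(1)] by (simp del: atLeastAtMost_iff)
qed

lemma twist_in_pairs:
  "\<sigma> permutes {1..n} \<Longrightarrow> w \<in> words (pairs n) \<Longrightarrow> set (twist \<sigma> w) \<subseteq> pairs n"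
proof (induction w arbitrary: \<sigma>)
  case (Cons x w)
  hence "\<sigma> \<circ> pair_transp (fst x) permutes {1..n}"
    by (intro permutes_compose transp_permutes) auto
  thus ?case
    using Cons.prems Cons.IH[of "\<sigma> \<circ> pair_transp (fst x)"] image_in_pairs
    by (simp del: o_apply comp_apply)
qed auto

lemma transp_transp [simp]: "e \<in> pairs n \<Longrightarrow> pair_transp e \<circ> pair_transp e = id"
  by (auto simp: pairs_def)

lemma transp_image: "e \<in> pairs n \<Longrightarrow> pair_transp e ` e = e"
  by (auto simp: pairs_def)

lemma C2_square:
  assumes "e \<in> pairs n"
  shows "pres_eq (pairs n) (C2_rels n) (pos [e, e]) []"
proof (rule pres_eq.rel)
  from assms show "(pos [e, e], []) \<in> C2_rels n"
    unfolding pairs_def C2_rels_def by auto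
qed (use assms in auto)

lemma C2_braid:
  assumes "{i, j, k} \<subseteq> {1..n}" "distinct [i, j, k]"
  shows "pres_eq (pairs n) (C2_rels n) (pos [{i,j}, {j,k}, {i,j}]) (pos [{j,k}, {i,j}, {j,k}])"
proof -
  let ?E = "pres_eq (pairs n) (C2_rels n)"
  let ?a = "{i, j}" and ?b = "{j, k}"
  have a: "?a \<in> pairs n" and b: "?b \<in> pairs n" using assms by auto
  have "(pos [{j,i}, {j,k}, {j,i}, {j,k}, {j,i}, {j,k}], []) \<in> C2_rels n"
    unfolding C2_rels_def using assms by fastforce
  hence cube: "?E (pos [?a, ?b, ?a, ?b, ?a, ?b]) []"
    using a b by (intro pres_eq.rel) (auto simp: insert_commute)
  have E_refl: "?E (pos w) (pos w)" if "set w \<subseteq> {?a, ?b}" for w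
    using that a b by (intro pres_eq.refl) auto
  have red: "?E (pos (u @ [e, e] @ v)) (pos (u @ v))"
    if "e \<in> {?a, ?b}" "set u \<subseteq> {?a, ?b}" "set v \<subseteq> {?a, ?b}" for e u v
    using pres_eq.append[OF E_refl[OF that(2)] pres_eq.append[OF C2_square E_refl[OF that(3)]], of e]
      that a b by auto
  have "?E (pos ([?a, ?b, ?a, ?b, ?a, ?b] @ [?b, ?a, ?b])) (pos [?b, ?a, ?b])"
    using pres_eq.append[OF cube E_refl[of "[?b, ?a, ?b]"]] by simp
  moreover have "?E (pos ([?a, ?b, ?a, ?b, ?a, ?b] @ [?b, ?a, ?b])) (pos [?a, ?b, ?a])"
    using red[of ?b "[?a, ?b, ?a, ?b, ?a]" "[?a, ?b]"] red[of ?a "[?a, ?b, ?a, ?b]" "[?b]"]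
      red[of ?b "[?a, ?b, ?a]" "[]"]
    by (auto intro: pres_eq.trans)
  ultimately show ?thesis
    by (meson pres_eq.sym pres_eq.trans)
qed

lemma G2_rels_twist:
  assumes "(u, v) \<in> G2_rels n" "\<sigma> permutes {1..n}"
  shows "perm u = perm v \<and> pres_eq (pairs n) (C2_rels n) (pos (twist \<sigma> u)) (pos (twist \<sigma> v))"
proof -
  have inj: "\<sigma> x = \<sigma> y \<longleftrightarrow> x = y" for x y
    using permutes_inj[OF assms(2)] by (auto simp: inj_eq)
  have mem: "\<sigma> x \<in> {1..n} \<longleftrightarrow> x \<in> {1..n}" for x
    using permutes_in_image[OF assms(2)] .
  from assms(1) show ?thesis
  proof (cases rule: G2_rels_cases)
    case (triangle i j k)
    have "perm u = perm v"
      using triangle transpose_triangle[of i j k] by (simp add: comp_assoc del: comp_apply)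
    moreover have "twist \<sigma> u = [{\<sigma> i, \<sigma> j}, {\<sigma> j, \<sigma> k}, {\<sigma> i, \<sigma> j}]"
      "twist \<sigma> v = [{\<sigma> j, \<sigma> k}, {\<sigma> i, \<sigma> j}, {\<sigma> j, \<sigma> k}]"
      using triangle by (auto simp: transpose_def insert_commute)
    ultimately show ?thesis
      using C2_braid[of "\<sigma> i" "\<sigma> j" "\<sigma> k" n] triangle mem inj by auto
  next
    case (far i j k l)
    have "perm u = perm v"
      using far transpose_far[of i j k l] by (simp del: comp_apply)
    moreover have "twist \<sigma> u = [{\<sigma> i, \<sigma> j}, {\<sigma> k, \<sigma> l}]" "twist \<sigma> v = [{\<sigma> k, \<sigma> l}, {\<sigma> i, \<sigma> j}]"
      using far by (auto simp: transpose_def)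
    moreover have idx: "{\<sigma> i, \<sigma> j, \<sigma> k, \<sigma> l} \<subseteq> {1..n}" "distinct [\<sigma> i, \<sigma> j, \<sigma> k, \<sigma> l]"
      using far mem inj by auto
    have "(pos [{\<sigma> i, \<sigma> j}, {\<sigma> k, \<sigma> l}], pos [{\<sigma> k, \<sigma> l}, {\<sigma> i, \<sigma> j}]) \<in> C2_rels n"
      unfolding C2_rels_def using idx by blast
    hence "pres_eq (pairs n) (C2_rels n) (pos [{\<sigma> i, \<sigma> j}, {\<sigma> k, \<sigma> l}]) (pos [{\<sigma> k, \<sigma> l}, {\<sigma> i, \<sigma> j}])"
      using idx by (intro pres_eq.rel) auto
    ultimately show ?thesis by simp
  next
    case (square i j)
    have "{\<sigma> i, \<sigma> j} \<in> pairs n" using square mem inj by auto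
    from C2_square[OF this] show ?thesis
      using square by (auto simp: insert_commute)
  qed
qed

lemma pres_eq_twist:
  assumes "pres_eq (pairs n) (G2_rels n) u v"
  shows "perm u = perm v \<and> (\<forall>\<sigma>. \<sigma> permutes {1..n} \<longrightarrow>
    pres_eq (pairs n) (C2_rels n) (pos (twist \<sigma> u)) (pos (twist \<sigma> v)))"
  using assms
proof (induction rule: pres_eq.induct)
  case (refl u)
  thus ?case by (simp add: pres_eq.refl twist_in_pairs)
next
  case (sym u v)
  thus ?case by (auto intro: pres_eq.sym)
next
  case (trans u v w)
  thus ?case by (auto intro: pres_eq.trans)
next
  case (append u u' v v')
  have "perm u permutes {1..n}"
    using append.hyps pres_eq_words perm_permutes by blast
  hence "\<sigma> \<circ> perm u permutes {1..n}" if "\<sigma> permutes {1..n}" for \<sigma>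
    using that by (rule permutes_compose)
  thus ?case using append.IH
    unfolding twist_append perm_append pos_simps by (metis pres_eq.append)
next
  case (cancel g e)
  have "pres_eq (pairs n) (C2_rels n) (pos [\<sigma> ` g, \<sigma> ` g]) []" if "\<sigma> permutes {1..n}" for \<sigma>
    using C2_square image_in_pairs cancel that by blast
  moreover have "(\<sigma> \<circ> pair_transp g) ` g = \<sigma> ` g" for \<sigma> :: "nat \<Rightarrow> nat"
    using transp_image[OF cancel] by (simp only: image_comp[symmetric])
  ultimately show ?case
    using transp_transp[OF cancel] by (simp del: comp_apply)
next
  case (rel u v)
  thus ?case using G2_rels_twist permutes_id by blast
qed

lemma l_hom_G2_elem:
  "set w \<subseteq> pairs n \<Longrightarrow> l_hom n (G2_elem n w) = word_eval (Sym_lr n) pair_transp (pos w)"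
  using induced_hom_pres_class[OF Sym_lr_is_group transp_in_Sym_lr G2_rels_sound, where w = "pos w"]
  by (simp add: l_hom_def G2_elem_def)

lemma inv_Sym_lr:
  assumes "set w \<subseteq> pairs n"
  shows "inv\<^bsub>Sym_lr n\<^esub> (l_hom n (G2_elem n w)) = perm (pos w)"
proof -
  interpret S: group "Sym_lr n" by (rule Sym_lr_is_group)
  have "perm (pos w) \<otimes>\<^bsub>Sym_lr n\<^esub> word_eval (Sym_lr n) pair_transp (pos w) = \<one>\<^bsub>Sym_lr n\<^esub>"
    using assms
  proof (induction w)
    case (Cons e w)
    let ?v = "word_eval (Sym_lr n) pair_transp (pos w)"
    have "(?v \<circ> pair_transp e) \<circ> (pair_transp e \<circ> perm (pos w)) = ?v \<circ> (pair_transp e \<circ> pair_transp e) \<circ> perm (pos w)"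
      by (simp only: comp_assoc)
    also have "\<dots> = ?v \<circ> perm (pos w)"
      using Cons.prems transp_transp[of e n] by simp
    finally show ?case using Cons by (simp del: comp_apply)
  qed auto
  thus ?thesis
    using assms perm_permutes[of "pos w" n]
      word_eval_closed[OF Sym_lr_is_group transp_in_Sym_lr, of "pos w" n]
    by (subst l_hom_G2_elem) (auto intro: S.inv_equality)
qed

lemma sig_eq: "set w \<subseteq> pairs n \<Longrightarrow> sig n w p = perm (pos (take p w))"
  unfolding sig_def by (intro inv_Sym_lr) (meson order_trans set_take_subset)

lemma sig_0: "sig n w 0 = id"
  using inv_Sym_lr[of "[]" n] by (simp add: sig_def)

lemma sig_Suc:
  assumes "set w \<subseteq> pairs n" "p < length w"
  shows "sig n w (Suc p) = sig n w p \<circ> pair_transp (w ! p)"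
  using assms by (simp add: sig_eq take_Suc_conv_app_nth perm_append)

lemma tilde_eq_twist:
  assumes "set w \<subseteq> pairs n"
  shows "tilde n w = twist id (pos w)"
proof -
  have "length (twist \<sigma> u) = length u" for \<sigma> u
    by (induction u arbitrary: \<sigma>) auto
  moreover have "twist \<sigma> u ! p = (\<sigma> \<circ> perm (take p u)) ` fst (u ! p)" if "p < length u" for \<sigma> u p
    using that
  proof (induction u arbitrary: \<sigma> p)
    case (Cons x u)
    thus ?case by (cases p) (auto simp: comp_assoc)
  qed auto
  ultimately show ?thesis
    using assms
    by (intro nth_equalityI) (auto simp: tilde_def sig_eq pos_def take_map)
qed

lemma co_G2_elem:
  assumes "w \<in> lists (pairs n)"
  shows "co n (G2_elem n w) = C2_elem n (tilde n w)"
  unfolding co_def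
proof (rule the_equality)
  fix Y assume "\<exists>v\<in>lists (pairs n). G2_elem n w = G2_elem n v \<and> Y = C2_elem n (tilde n v)"
  then obtain v where v: "v \<in> lists (pairs n)" "G2_elem n w = G2_elem n v" "Y = C2_elem n (tilde n v)"
    by blast
  have "pres_eq (pairs n) (G2_rels n) (pos w) (pos v)"
    using v(1,2) assms unfolding G2_elem_def
    by (subst pres_class_eq_iff[symmetric]) auto
  hence "pres_eq (pairs n) (C2_rels n) (pos (twist id (pos w))) (pos (twist id (pos v)))"
    using pres_eq_twist permutes_id by blast
  moreover have "set (twist id (pos w)) \<subseteq> pairs n"
    using assms by (intro twist_in_pairs) (auto simp: permutes_id)
  ultimately show "Y = C2_elem n (tilde n w)"
    using v assms unfolding C2_elem_def
    by (subst tilde_eq_twist, force, subst v(3), subst C2_elem_def, subst tilde_eq_twist, force)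
       (metis pres_class_eq_iff pos_in_words)
qed (use assms in blast)

declare One_nat_def [simp]

end

theory Submission
  imports Defs
begin

text \<open>
  The rewriting replaces each letter \<open>e\<close> by \<open>\<sigma> ` e\<close>, where \<open>\<sigma>\<close> is the composition of the
  transpositions of the letters already read. Writing
  \<open>t\<^sub>e\<close> for the transposition of \<open>e\<close>, one has \<open>t\<^bsub>\<sigma> e\<^esub> = \<sigma> t\<^sub>e \<sigma>\<inverse>\<close>; hence, while the original word
  accumulates \<open>\<sigma> t\<^sub>e\<close>, the rewritten word accumulates
  \<open>\<sigma>\<inverse> t\<^bsub>\<sigma> e\<^esub> = (\<sigma> t\<^sub>e)\<inverse>\<close>. So a second rewriting undoes the first one letter by letter:
  on words the rewriting is an involution (\<open>twist_twist\<close>), and it replaces the permutation of a word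
  by its inverse (\<open>perm_twist\<close>), so that it preserves the words with trivial permutation.

  The theorem therefore reduces to the fact that the same rewriting carries equal elements of
  \<open>C(n,2)\<close> to equal elements of \<open>G\<^sub>n\<^sup>2\<close> (\<open>pres_eq_twist_C2\<close>), the converse of the statement that makes
  \<open>co\<close> well defined. The only relation that changes its shape is \<open>(b\<^sub>i\<^sub>j b\<^sub>i\<^sub>k)\<^sup>3 = 1\<close>. It becomes
  \<open>a\<^sub>i\<^sub>j a\<^sub>j\<^sub>k a\<^sub>i\<^sub>k a\<^sub>i\<^sub>j a\<^sub>j\<^sub>k a\<^sub>i\<^sub>k = 1\<close>, which is the triangle relation of \<open>G\<^sub>n\<^sup>2\<close> because the
  generators are involutions (\<open>G2_hexagon\<close>). Finally \<open>co\<close> is multiplicative on the kernel, since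
  after a word with trivial permutation the rewriting starts afresh from the identity.
\<close>

section \<open>Presentations whose generators are involutions\<close>

lemma pres_eq_inverse_letter:
  assumes g: "g \<in> S" and sq: "pres_eq S R (pos [g, g]) []"
  shows "pres_eq S R [(g, False)] [(g, True)]"
proof -
  have letter: "pres_eq S R [(g, e)] [(g, e)]" for e
    using g by (intro pres_eq.refl) simp
  have "pres_eq S R ([(g, False)] @ pos [g, g]) ([(g, False)] @ [])"
    by (intro pres_eq.append letter sq)
  moreover have "pres_eq S R ([(g, False), (g, \<not> False)] @ [(g, True)]) ([] @ [(g, True)])"
    by (intro pres_eq.append letter pres_eq.cancel g)
  ultimately show ?thesis
    by (auto intro: pres_eq.sym pres_eq.trans)
qed

lemma pres_eq_forget_signs:
  assumes sq: "\<And>g. g \<in> S \<Longrightarrow> pres_eq S R (pos [g, g]) []" and "w \<in> words S"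
  shows "pres_eq S R w (pos (map fst w))"
  using assms(2)
proof (induction w)
  case (Cons x w)
  have "pres_eq S R [x] [(fst x, True)]"
    using Cons.prems pres_eq_inverse_letter[OF _ sq, of "fst x"]
    by (cases x; cases "snd x") (auto intro: pres_eq.refl)
  from pres_eq.append[OF this Cons.IH] Cons.prems show ?case by simp
qed (simp add: pres_eq.refl)

lemma carrier_presented_group_pos:
  assumes "\<And>g. g \<in> S \<Longrightarrow> pres_eq S R (pos [g, g]) []"
  shows "carrier (presented_group S R) = (\<lambda>w. pres_class S R (pos w)) ` lists S"
proof -
  have "pres_class S R w \<in> (\<lambda>w. pres_class S R (pos w)) ` lists S" if w: "w \<in> words S" for w
  proof (rule image_eqI)
    show "pres_class S R w = pres_class S R (pos (map fst w))"
      using pres_eq_forget_signs[of S R, OF assms w] by (simp add: pres_class_eq_iff w)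
    show "map fst w \<in> lists S"
      using w by (auto simp: words_iff in_lists_conv_set)
  qed
  thus ?thesis by (auto simp: presented_group_def in_lists_conv_set subset_iff)
qed

lemma pres_eq_rev_append:
  assumes sq: "\<And>g. g \<in> S \<Longrightarrow> pres_eq S R (pos [g, g]) []" and "set w \<subseteq> S"
  shows "pres_eq S R (pos (rev w @ w)) []"
  using assms(2)
proof (induction w)
  case (Cons g w)
  have "pres_eq S R (pos (rev w) @ pos [g, g] @ pos w) (pos (rev w) @ [] @ pos w)"
    using Cons.prems by (intro pres_eq.append pres_eq.refl sq) auto
  moreover have "pres_eq S R (pos (rev w @ w)) []"
    using Cons by simp
  ultimately show ?case by (auto intro: pres_eq.trans)
qed (simp add: pres_eq.refl)

section \<open>Elements of the two groups as positive words\<close>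

lemma G2_square:
  assumes "e \<in> pairs n"
  shows "pres_eq (pairs n) (G2_rels n) (pos [e, e]) []"
proof (rule pres_eq.rel)
  from assms show "(pos [e, e], []) \<in> G2_rels n"
    unfolding pairs_def G2_rels_def by auto
qed (use assms in auto)

lemma carrier_G2: "carrier (G2 n) = G2_elem n ` lists (pairs n)"
  using carrier_presented_group_pos[OF G2_square] by (simp add: G2_def G2_elem_def)

lemma carrier_C2: "carrier (C2 n) = C2_elem n ` lists (pairs n)"
  using carrier_presented_group_pos[OF C2_square] by (simp add: C2_def C2_elem_def)

lemma G2_elem_eq_iff:
  "set u \<subseteq> pairs n \<Longrightarrow>
    G2_elem n u = G2_elem n v \<longleftrightarrow> pres_eq (pairs n) (G2_rels n) (pos u) (pos v)"
  by (simp add: G2_elem_def pres_class_eq_iff)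

lemma C2_elem_eq_iff:
  "set u \<subseteq> pairs n \<Longrightarrow>
    C2_elem n u = C2_elem n v \<longleftrightarrow> pres_eq (pairs n) (C2_rels n) (pos u) (pos v)"
  by (simp add: C2_elem_def pres_class_eq_iff)

lemma G2_elem_mult:
  "set u \<subseteq> pairs n \<Longrightarrow> set v \<subseteq> pairs n \<Longrightarrow>
    G2_elem n u \<otimes>\<^bsub>G2 n\<^esub> G2_elem n v = G2_elem n (u @ v)"
  by (simp add: G2_elem_def G2_def pres_class_mult)

lemma C2_elem_mult:
  "set u \<subseteq> pairs n \<Longrightarrow> set v \<subseteq> pairs n \<Longrightarrow>
    C2_elem n u \<otimes>\<^bsub>C2 n\<^esub> C2_elem n v = C2_elem n (u @ v)"
  by (simp add: C2_elem_def C2_def pres_class_mult)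

lemma l_hom_eq_id_iff:
  assumes "set w \<subseteq> pairs n"
  shows "l_hom n (G2_elem n w) = id \<longleftrightarrow> perm (pos w) = id"
proof -
  interpret S: group "Sym_lr n" by (rule Sym_lr_is_group)
  have "l_hom n (G2_elem n w) \<in> carrier (Sym_lr n)"
    using assms word_eval_closed[OF Sym_lr_is_group transp_in_Sym_lr, of "pos w" n]
    by (simp add: l_hom_G2_elem del: Sym_lr_carrier)
  from S.inv_eq_1_iff[OF this] show ?thesis
    by (simp add: inv_Sym_lr[OF assms])
qed

text \<open>Both homomorphisms evaluate a word to the same product of transpositions, so the kernel
  condition for \<open>m\<close> is inherited from the one for \<open>l\<close>.\<close>

lemma m_hom_C2_elem:
  assumes "set w \<subseteq> pairs n"
  shows "m_hom n (C2_elem n w) = l_hom n (G2_elem n w)"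
  using assms l_hom_G2_elem[OF assms]
    induced_hom_pres_class[OF Sym_lr_is_group transp_in_Sym_lr C2_rels_sound, where w = "pos w"]
  by (simp add: m_hom_def C2_elem_def)

lemma carrier_Ker_l:
  "carrier (Ker_l n) = G2_elem n ` {w \<in> lists (pairs n). perm (pos w) = id}"
  using l_hom_eq_id_iff[of _ n]
  by (auto simp: Ker_l_def kernel_def carrier_G2 in_lists_conv_set subset_iff)

lemma carrier_Ker_m:
  "carrier (Ker_m n) = C2_elem n ` {w \<in> lists (pairs n). perm (pos w) = id}"
  using l_hom_eq_id_iff[of _ n] m_hom_C2_elem[of _ n]
  by (auto simp: Ker_m_def kernel_def carrier_C2 in_lists_conv_set subset_iff)

section \<open>The rewriting is an involution on words\<close>

text \<open>Relabelling the points of a transposition by \<open>\<sigma>\<close> is conjugation by \<open>\<sigma>\<close>.\<close>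

lemma pair_transp_image:
  assumes "\<sigma> permutes {1..n}" "e \<in> pairs n"
  shows "pair_transp (\<sigma> ` e) \<circ> \<sigma> = \<sigma> \<circ> pair_transp e"
proof -
  obtain i j where e: "e = {i, j}"
    using assms(2) unfolding pairs_def by blast
  have "\<sigma> x = \<sigma> y \<longleftrightarrow> x = y" for x y
    using permutes_inj[OF assms(1)] by (auto simp: inj_eq)
  thus ?thesis
    by (intro ext) (simp add: e transpose_def)
qed

text \<open>Since \<open>t\<^bsub>\<sigma> e\<^esub> \<sigma> t\<^sub>e = \<sigma>\<close>, the letters of a word and of its rewriting cancel one by one. For
  \<open>\<sigma> = id\<close> this says that the rewritten word has the inverse permutation.\<close>

lemma perm_twist:
  assumes "\<sigma> permutes {1..n}" "w \<in> words (pairs n)"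
  shows "perm (pos (twist \<sigma> w)) \<circ> (\<sigma> \<circ> perm w) = \<sigma>"
  using assms
proof (induction w arbitrary: \<sigma>)
  case (Cons x w)
  let ?t = "pair_transp (fst x)" and ?s = "pair_transp (\<sigma> ` fst x)"
  have x: "fst x \<in> pairs n" using Cons.prems by simp
  have "\<sigma> \<circ> ?t permutes {1..n}"
    using Cons.prems(1) x by (intro permutes_compose transp_permutes)
  hence IH: "perm (pos (twist (\<sigma> \<circ> ?t) w)) \<circ> ((\<sigma> \<circ> ?t) \<circ> perm w) = \<sigma> \<circ> ?t"
    using Cons.prems(2) by (intro Cons.IH) (simp_all del: comp_apply)
  have "perm (pos (twist \<sigma> (x # w))) \<circ> (\<sigma> \<circ> perm (x # w))
      = ?s \<circ> (perm (pos (twist (\<sigma> \<circ> ?t) w)) \<circ> ((\<sigma> \<circ> ?t) \<circ> perm w))"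
    by (simp add: comp_assoc del: comp_apply)
  also have "\<dots> = (?s \<circ> \<sigma>) \<circ> ?t"
    by (subst IH) (simp only: comp_assoc)
  also have "\<dots> = \<sigma> \<circ> (?t \<circ> ?t)"
    by (simp only: pair_transp_image[OF Cons.prems(1) x] comp_assoc)
  finally show ?case
    by (simp only: transp_transp[OF x] comp_id)
qed simp

text \<open>The two rewritings stay mutually inverse after each letter:
  \<open>\<rho> t\<^bsub>\<sigma> e\<^esub> \<sigma> t\<^sub>e = \<rho> \<sigma> = id\<close>.\<close>

lemma twist_twist:
  assumes "\<rho> \<circ> \<sigma> = id" "\<sigma> permutes {1..n}" "w \<in> words (pairs n)"
  shows "twist \<rho> (pos (twist \<sigma> w)) = map fst w"
  using assms
proof (induction w arbitrary: \<rho> \<sigma>)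
  case (Cons x w)
  let ?t = "pair_transp (fst x)" and ?s = "pair_transp (\<sigma> ` fst x)"
  have x: "fst x \<in> pairs n" using Cons.prems by simp
  have "(\<rho> \<circ> ?s) \<circ> (\<sigma> \<circ> ?t) = \<rho> \<circ> ((?s \<circ> \<sigma>) \<circ> ?t)"
    by (simp only: comp_assoc)
  also have "\<dots> = (\<rho> \<circ> \<sigma>) \<circ> (?t \<circ> ?t)"
    by (simp only: pair_transp_image[OF Cons.prems(2) x] comp_assoc)
  finally have "(\<rho> \<circ> ?s) \<circ> (\<sigma> \<circ> ?t) = id"
    by (simp only: Cons.prems(1) transp_transp[OF x] comp_id)
  moreover have "\<sigma> \<circ> ?t permutes {1..n}"
    using Cons.prems(2) x by (intro permutes_compose transp_permutes)
  ultimately have "twist (\<rho> \<circ> ?s) (pos (twist (\<sigma> \<circ> ?t) w)) = map fst w"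
    using Cons.prems(3) by (intro Cons.IH) (simp_all del: comp_apply)
  moreover have "\<rho> ` \<sigma> ` fst x = fst x"
    using Cons.prems(1) by (metis image_comp image_id id_apply)
  ultimately show ?case
    by (simp del: comp_apply)
qed simp

lemma tilde_in_pairs: "set w \<subseteq> pairs n \<Longrightarrow> set (tilde n w) \<subseteq> pairs n"
  by (simp add: tilde_eq_twist twist_in_pairs permutes_id)

lemma tilde_tilde:
  assumes "set w \<subseteq> pairs n"
  shows "tilde n (tilde n w) = w"
proof -
  have "tilde n (tilde n w) = twist id (pos (twist id (pos w)))"
    using tilde_in_pairs[OF assms] by (simp add: tilde_eq_twist assms)
  also have "\<dots> = map fst (pos w)"
    using assms by (intro twist_twist[where n = n]) (simp_all add: permutes_id)
  finally show ?thesis by (simp add: pos_def comp_def)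
qed

lemma perm_tilde:
  assumes "set w \<subseteq> pairs n" "perm (pos w) = id"
  shows "perm (pos (tilde n w)) = id"
  using perm_twist[of id n "pos w"] assms by (simp add: tilde_eq_twist permutes_id)

lemma tilde_append:
  assumes "set u \<subseteq> pairs n" "set v \<subseteq> pairs n" "perm (pos u) = id"
  shows "tilde n (u @ v) = tilde n u @ tilde n v"
  using assms by (simp add: tilde_eq_twist twist_append)

section \<open>The rewriting respects the relations of the Coxeter group\<close>

text \<open>The triangle relation turns the first half of the hexagon into its second half read backwards,
  and the two halves cancel because the generators are involutions.\<close>

lemma G2_hexagon:
  assumes "{i, j, k} \<subseteq> {1..n}" "distinct [i, j, k]"
  shows "pres_eq (pairs n) (G2_rels n) (pos [{i,j}, {j,k}, {i,k}, {i,j}, {j,k}, {i,k}]) []"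
proof -
  let ?E = "pres_eq (pairs n) (G2_rels n)" and ?h = "[{i,j}, {j,k}, {i,k}]"
  have h: "set ?h \<subseteq> pairs n" using assms by auto
  \<comment> \<open>the triangle relation with \<open>j\<close> as the common index of the first two generators\<close>
  have "(pos [{j,i}, {j,k}, {i,k}], pos [{i,k}, {j,k}, {j,i}]) \<in> G2_rels n"
    unfolding G2_rels_def using assms by fastforce
  hence "?E (pos ?h) (pos (rev ?h))"
    using h by (intro pres_eq.rel) (auto simp: insert_commute)
  hence "?E (pos ?h @ pos ?h) (pos (rev ?h) @ pos ?h)"
    using h by (intro pres_eq.append pres_eq.refl) auto
  moreover have "?E (pos (rev ?h @ ?h)) []"
    by (rule pres_eq_rev_append[OF G2_square h])
  ultimately show ?thesis
    by (auto intro: pres_eq.trans)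
qed

lemma C2_rels_twist:
  assumes "(u, v) \<in> C2_rels n" "\<sigma> permutes {1..n}"
  shows "perm u = perm v \<and> pres_eq (pairs n) (G2_rels n) (pos (twist \<sigma> u)) (pos (twist \<sigma> v))"
proof -
  have inj: "\<sigma> x = \<sigma> y \<longleftrightarrow> x = y" for x y
    using permutes_inj[OF assms(2)] by (auto simp: inj_eq)
  have mem: "\<sigma> x \<in> {1..n} \<longleftrightarrow> x \<in> {1..n}" for x
    using permutes_in_image[OF assms(2)] .
  from assms(1) show ?thesis
  proof (cases rule: C2_rels_cases)
    case (triangle i j k)
    have "perm u = perm v"
      using triangle transpose_cube[of i k j] by (simp add: comp_assoc del: comp_apply)
    moreover have ne: "i \<noteq> j" "j \<noteq> i" "i \<noteq> k" "k \<noteq> i" "j \<noteq> k" "k \<noteq> j"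
      using triangle(2) by auto
    have "twist \<sigma> u = [{\<sigma> i, \<sigma> j}, {\<sigma> j, \<sigma> k}, {\<sigma> i, \<sigma> k}, {\<sigma> i, \<sigma> j}, {\<sigma> j, \<sigma> k}, {\<sigma> i, \<sigma> k}]"
      using ne by (simp add: triangle(3) transpose_def insert_commute)
    ultimately show ?thesis
      using G2_hexagon[of "\<sigma> i" "\<sigma> j" "\<sigma> k" n] triangle mem inj by auto
  next
    case (far i j k l)
    have "perm u = perm v"
      using far transpose_far[of i j k l] by (simp del: comp_apply)
    moreover have "twist \<sigma> u = [{\<sigma> i, \<sigma> j}, {\<sigma> k, \<sigma> l}]" "twist \<sigma> v = [{\<sigma> k, \<sigma> l}, {\<sigma> i, \<sigma> j}]"
      using far by (auto simp: transpose_def)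
    moreover have idx: "{\<sigma> i, \<sigma> j, \<sigma> k, \<sigma> l} \<subseteq> {1..n}" "distinct [\<sigma> i, \<sigma> j, \<sigma> k, \<sigma> l]"
      using far mem inj by auto
    have "(pos [{\<sigma> i, \<sigma> j}, {\<sigma> k, \<sigma> l}], pos [{\<sigma> k, \<sigma> l}, {\<sigma> i, \<sigma> j}]) \<in> G2_rels n"
      unfolding G2_rels_def using idx by blast
    hence "pres_eq (pairs n) (G2_rels n) (pos [{\<sigma> i, \<sigma> j}, {\<sigma> k, \<sigma> l}]) (pos [{\<sigma> k, \<sigma> l}, {\<sigma> i, \<sigma> j}])"
      using idx by (intro pres_eq.rel) auto
    ultimately show ?thesis by simp
  next
    case (square i j)
    have "{\<sigma> i, \<sigma> j} \<in> pairs n" using square mem inj by auto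
    from G2_square[OF this] show ?thesis
      using square by (auto simp: insert_commute)
  qed
qed

text \<open>The starting permutation \<open>\<sigma>\<close> has to be arbitrary and the permutations of \<open>u\<close> and \<open>v\<close> have to
  agree, because the second factor of a product is rewritten starting from the permutation reached
  after the first.\<close>

lemma pres_eq_twist_C2:
  assumes "pres_eq (pairs n) (C2_rels n) u v"
  shows "perm u = perm v \<and> (\<forall>\<sigma>. \<sigma> permutes {1..n} \<longrightarrow>
    pres_eq (pairs n) (G2_rels n) (pos (twist \<sigma> u)) (pos (twist \<sigma> v)))"
  using assms
proof (induction rule: pres_eq.induct)
  case (refl u)
  thus ?case by (simp add: pres_eq.refl twist_in_pairs)
next
  case (sym u v)
  thus ?case by (auto intro: pres_eq.sym)
next
  case (trans u v w)
  thus ?case by (auto intro: pres_eq.trans)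
next
  case (append u u' v v')
  have "perm u permutes {1..n}"
    using append.hyps pres_eq_words perm_permutes by blast
  hence "\<sigma> \<circ> perm u permutes {1..n}" if "\<sigma> permutes {1..n}" for \<sigma>
    using that by (rule permutes_compose)
  thus ?case using append.IH
    unfolding twist_append perm_append pos_simps by (metis pres_eq.append)
next
  case (cancel g e)
  have "pres_eq (pairs n) (G2_rels n) (pos [\<sigma> ` g, \<sigma> ` g]) []" if "\<sigma> permutes {1..n}" for \<sigma>
    using G2_square image_in_pairs cancel that by blast
  moreover have "(\<sigma> \<circ> pair_transp g) ` g = \<sigma> ` g" for \<sigma> :: "nat \<Rightarrow> nat"
    using transp_image[OF cancel] by (simp only: image_comp[symmetric])
  ultimately show ?case
    using transp_transp[OF cancel] by (simp del: comp_apply)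
next
  case (rel u v)
  thus ?case using C2_rels_twist permutes_id by blast
qed

text \<open>Together with \<open>tilde_tilde\<close>, this makes \<open>co\<close> injective.\<close>

lemma C2_elem_eq_imp_G2_elem_tilde_eq:
  assumes "set u \<subseteq> pairs n" "set v \<subseteq> pairs n" "C2_elem n u = C2_elem n v"
  shows "G2_elem n (tilde n u) = G2_elem n (tilde n v)"
proof -
  have "pres_eq (pairs n) (C2_rels n) (pos u) (pos v)"
    using assms C2_elem_eq_iff by blast
  hence "pres_eq (pairs n) (G2_rels n) (pos (twist id (pos u))) (pos (twist id (pos v)))"
    using pres_eq_twist_C2 permutes_id by blast
  thus ?thesis
    using assms tilde_in_pairs[OF assms(1)] by (simp add: G2_elem_eq_iff tilde_eq_twist)
qed

section \<open>The isomorphism of kernels\<close>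

theorem theorem2:
  fixes n :: nat
  assumes "n > 2"
  shows "co n \<in> iso (Ker_l n) (Ker_m n)"
proof -
  define K where "K = {w \<in> lists (pairs n). perm (pos w) = id}"
  have l: "carrier (Ker_l n) = G2_elem n ` K" and m: "carrier (Ker_m n) = C2_elem n ` K"
    by (simp_all add: K_def carrier_Ker_l carrier_Ker_m)
  have K: "set w \<subseteq> pairs n" "w \<in> lists (pairs n)" "perm (pos w) = id" if "w \<in> K" for w
    using that by (auto simp: K_def)
  have tilde_K: "tilde n w \<in> K" if "w \<in> K" for w
    using tilde_in_pairs[OF K(1)[OF that]] perm_tilde[OF K(1)[OF that] K(3)[OF that]]
    by (auto simp: K_def)
  have co: "co n (G2_elem n w) = C2_elem n (tilde n w)" if "w \<in> K" for w
    using co_G2_elem K(2) that by blast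
  show ?thesis
  proof (rule isoI)
    show "co n \<in> hom (Ker_l n) (Ker_m n)"
    proof (rule homI)
      fix X assume "X \<in> carrier (Ker_l n)"
      then obtain u where u: "u \<in> K" "X = G2_elem n u" by (auto simp: l)
      show "co n X \<in> carrier (Ker_m n)"
        using u co tilde_K by (simp add: m)
      fix Y assume "Y \<in> carrier (Ker_l n)"
      then obtain v where v: "v \<in> K" "Y = G2_elem n v" by (auto simp: l)
      have "co n (G2_elem n (u @ v)) = C2_elem n (tilde n u @ tilde n v)"
        using K[OF u(1)] K[OF v(1)] by (simp add: co_G2_elem tilde_append)
      thus "co n (X \<otimes>\<^bsub>Ker_l n\<^esub> Y) = co n X \<otimes>\<^bsub>Ker_m n\<^esub> co n Y"
        using u v K(1) tilde_in_pairs
        by (simp add: Ker_l_def Ker_m_def co G2_elem_mult C2_elem_mult)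
    qed
    show "bij_betw (co n) (carrier (Ker_l n)) (carrier (Ker_m n))"
    proof (rule bij_betwI')
      fix X Y assume "X \<in> carrier (Ker_l n)" "Y \<in> carrier (Ker_l n)"
      then obtain u v where uv: "u \<in> K" "v \<in> K" "X = G2_elem n u" "Y = G2_elem n v"
        by (auto simp: l)
      have "X = Y" if "co n X = co n Y"
        using C2_elem_eq_imp_G2_elem_tilde_eq[of "tilde n u" n "tilde n v"] that uv K(1)
        by (simp add: co tilde_in_pairs tilde_tilde)
      thus "(co n X = co n Y) = (X = Y)" by blast
    next
      fix X assume "X \<in> carrier (Ker_l n)"
      thus "co n X \<in> carrier (Ker_m n)"
        using co tilde_K by (auto simp: l m)
    next
      fix Y assume "Y \<in> carrier (Ker_m n)"
      then obtain v where v: "v \<in> K" "Y = C2_elem n v" by (auto simp: m)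
      hence "Y = co n (G2_elem n (tilde n v))"
        using co[OF tilde_K] tilde_tilde[OF K(1)] by simp
      thus "\<exists>X\<in>carrier (Ker_l n). Y = co n X"
        using tilde_K[OF v(1)] by (auto simp: l)
    qed
  qed
qed

end
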